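(* Let $G$ be a $(1,1)$-regular mixed graph with diameter $k=3$ and order $N=10$ (the maximum order allowed by the bound $N\le M(1,1,3)-1=10$, where $M(1,1,3)=11$ is the Moore bound for mixed graphs with undirected degree $1$, directed out-degree $1$ and diameter $3$). Then $G$ is isomorphic to one of the three mixed graphs $G_a$, $G_b$, $G_c$, each with vertex set $\{v_0,v_1,\dots,v_9\}$ and edge set $$\{v_0v_1,\ v_2v_4,\ v_3v_6,\ v_5v_9,\ v_7v_8\},$$ whose arcs are: (a) $G_a$: $v_0\to v_2\to v_5\to v_8\to v_6\to v_0$ and $v_1\to v_3\to v_7\to v_9\to v_4\to v_1$ (two directed $5$-cycles; $G_a$ is the line digraph of the cycle $C_5$, where each edge of $C_5$ is seen as a digon); (b) $G_b$: $v_0\to v_2\to v_5\to v_8\to v_6\to v_9\to v_4\to v_1\to v_3\to v_7\to v_0$ (a directed $10$-cycle); (c) $G_c$: $v_0\to v_2\to v_5\to v_8\to v_6\to v_9\to v_0$ and $v_1\to v_3\to v_7\to v_4\to v_1$ (a directed $6$-cycle and a directed $4$-cycle).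
   Context: A mixed graph $G=(V,E,A)$ consists of a set $V$ of vertices, a set $E$ of edges (unordered pairs of distinct vertices) and a set $A$ of arcs (ordered pairs of distinct vertices). Equivalently, $G$ is viewed as a digraph in which each edge is a digon (pair of opposite arcs). The undirected degree $r(u)$ of a vertex $u$ is the number of edges incident to $u$; the out-degree $z^+(u)$ (in-degree $z^-(u)$) is the number of arcs of $A$ emanating from (pointing to) $u$. $G$ is $(r,z)$-regular if $r(u)=r$ and $z^+(u)=z^-(u)=z$ for all $u\in V$; thus in a $(1,1)$-regular mixed graph every vertex is incident to exactly one edge, has exactly one outgoing arc and exactly one incoming arc. The distance $\mathrm{dist}(u,v)$ is the length of a shortest path from $u$ to $v$, where edges can be traversed in both directions and arcs only in their direction; the diameter is the maximum of $\mathrm{dist}(u,v)$ over all ordered pairs of vertices. An isomorphism of mixed graphs is a bijection of vertex sets preserving edges and arcs in both directions. *)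

theory Defs
  imports "Graph_Theory.Graph_Theory"
begin

record 'a pre_mixed_graph =
  mverts :: "'a set"
  medges :: "'a set set"
  marcs :: "'a rel"

text \<open>
  Edges and arcs are not required to be disjoint: an arc may join the two ends of an edge, and
  two opposite arcs may both be present.
\<close>

locale mixed_graph =
  fixes G :: "'a pre_mixed_graph"
  assumes edges_wf: "e \<in> medges G \<Longrightarrow> \<exists>u\<in>mverts G. \<exists>v\<in>mverts G. u \<noteq> v \<and> e = {u, v}"
    and arcs_wf: "(u, v) \<in> marcs G \<Longrightarrow> u \<in> mverts G \<and> v \<in> mverts G \<and> u \<noteq> v"

definition undirected_degree :: "'a pre_mixed_graph \<Rightarrow> 'a \<Rightarrow> nat" where
  "undirected_degree G u = card {e \<in> medges G. u \<in> e}"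

definition arc_out_degree :: "'a pre_mixed_graph \<Rightarrow> 'a \<Rightarrow> nat" where
  "arc_out_degree G u = card {a \<in> marcs G. fst a = u}"

definition arc_in_degree :: "'a pre_mixed_graph \<Rightarrow> 'a \<Rightarrow> nat" where
  "arc_in_degree G u = card {a \<in> marcs G. snd a = u}"

definition mixed_regular :: "nat \<Rightarrow> nat \<Rightarrow> 'a pre_mixed_graph \<Rightarrow> bool" where
  "mixed_regular r z G \<longleftrightarrow>
     (\<forall>u\<in>mverts G. undirected_degree G u = r \<and> arc_out_degree G u = z \<and> arc_in_degree G u = z)"

text \<open>
  The view of a mixed graph as a digraph. An arc joining the ends of an edge is
  identified with one half of the digon, which does not affect distances.
\<close>

definition digraph_of :: "'a pre_mixed_graph \<Rightarrow> 'a pair_pre_digraph" where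
  "digraph_of G =
     \<lparr> pverts = mverts G, parcs = marcs G \<union> {(u, v). {u, v} \<in> medges G} \<rparr>"

text \<open>
  The distance is the least cost \<open>\<mu>\<close> of a walk with all weights \<open>1\<close>, attained by a path. It is \<open>\<infinity>\<close> when there is
  no path, so a graph of finite diameter is strongly connected.
  The library specifies \<open>\<mu>\<close> for well-formed digraphs; \<open>digraph_of G\<close> is one if \<open>mixed_graph G\<close>.
\<close>

definition mixed_dist :: "'a pre_mixed_graph \<Rightarrow> 'a \<Rightarrow> 'a \<Rightarrow> ereal" where
  "mixed_dist G u v = wf_digraph.\<mu> (with_proj (digraph_of G)) (\<lambda>_. 1) u v"

definition mixed_diameter :: "'a pre_mixed_graph \<Rightarrow> ereal" where
  "mixed_diameter G = (SUP (u, v)\<in>mverts G \<times> mverts G. mixed_dist G u v)"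

definition mixed_iso :: "'a pre_mixed_graph \<Rightarrow> 'b pre_mixed_graph \<Rightarrow> bool" where
  "mixed_iso G H \<longleftrightarrow>
     (\<exists>f. bij_betw f (mverts G) (mverts H) \<and>
        (\<forall>u\<in>mverts G. \<forall>v\<in>mverts G.
           ({u, v} \<in> medges G \<longleftrightarrow> {f u, f v} \<in> medges H) \<and>
           ((u, v) \<in> marcs G \<longleftrightarrow> (f u, f v) \<in> marcs H)))"

definition cycle_graph :: "nat \<Rightarrow> nat pre_mixed_graph" where
  "cycle_graph n =
     \<lparr> mverts = {..<n}, medges = {{i, Suc i mod n} |i. i < n}, marcs = {} \<rparr>"

definition line_digraph :: "'a pair_pre_digraph \<Rightarrow> ('a \<times> 'a) pair_pre_digraph" where
  "line_digraph D =
     \<lparr> pverts = parcs D, parcs = {(a, b). a \<in> parcs D \<and> b \<in> parcs D \<and> snd a = fst b} \<rparr>"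

text \<open>In the three graphs below the number \<open>i\<close> stands for the vertex \<open>v\<^sub>i\<close>.\<close>

definition common_edges :: "nat set set" where
  "common_edges = {{0, 1}, {2, 4}, {3, 6}, {5, 9}, {7, 8}}"

definition G\<^sub>a :: "nat pre_mixed_graph" where
  "G\<^sub>a = \<lparr> mverts = {0..9}, medges = common_edges,
     marcs = {(0, 2), (2, 5), (5, 8), (8, 6), (6, 0),
              (1, 3), (3, 7), (7, 9), (9, 4), (4, 1)} \<rparr>"

definition G\<^sub>b :: "nat pre_mixed_graph" where
  "G\<^sub>b = \<lparr> mverts = {0..9}, medges = common_edges,
     marcs = {(0, 2), (2, 5), (5, 8), (8, 6), (6, 9),
              (9, 4), (4, 1), (1, 3), (3, 7), (7, 0)} \<rparr>"

definition G\<^sub>c :: "nat pre_mixed_graph" where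
  "G\<^sub>c = \<lparr> mverts = {0..9}, medges = common_edges,
     marcs = {(0, 2), (2, 5), (5, 8), (8, 6), (6, 9), (9, 0),
              (1, 3), (3, 7), (7, 4), (4, 1)} \<rparr>"

end

theory Submission
  imports Defs
begin

text \<open>
  Let \<open>f u\<close> be the other end of the edge at \<open>u\<close> and \<open>g u\<close> the head of the arc leaving \<open>u\<close>: \<open>f\<close> is an
  involution and \<open>g\<close> a permutation, both without fixed points, and they determine the graph.
  A shortest walk never crosses an edge twice in a row, and there are eleven words of length at
  most three in \<open>f\<close> and \<open>g\<close> without \<open>f f\<close>. Applied to any vertex \<open>u\<close> they must yield all ten
  vertices, so at each vertex exactly one of the eleven words is redundant.

  This leaves little room. A relation that would force a second one, such as \<open>g (g u) = f u\<close>, is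
  impossible. Eight of the words form pairs swapped by \<open>f\<close>, and the other three are \<open>g (g (f u))\<close>,
  \<open>g (f (g u))\<close> and \<open>g (g (g u))\<close>; if one of these three repeats one of the eight, the remaining two
  have nowhere else to go and are joined by an edge (\<open>leaves_adjacent\<close>). Together these facts reduce
  the coincidence at \<open>u\<close> to four types (\<open>coincidence\<close>); directed
  triangles need an argument of their own (\<open>g_g_g_neq\<close>). Comparing the coincidences at \<open>u\<close> and at
  \<open>g u\<close> then shows that one of the types, \<open>g (f (g u)) = f u\<close>, occurs at some vertex
  (\<open>ex_gfg_eq_f\<close>). The ten words at such a vertex label the graph: all five edges and six of the ten
  arcs are known. The excluded relations leave six ways to add the other four arcs, and each of the
  six graphs is, after relabelling, one of the three claimed (\<open>mixed_iso_if_square\<close>).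

  The identification of the first graph as a line digraph is an explicit bijection from its vertices
  to the arcs of the pentagon.
\<close>

section \<open>Degree one and the vertices within distance three\<close>

lemma mixed_graph_edge_verts:
  assumes "mixed_graph G" "{u, v} \<in> medges G"
  shows "u \<in> mverts G" "v \<in> mverts G" "u \<noteq> v"
proof -
  obtain x y where "x \<in> mverts G" "y \<in> mverts G" "x \<noteq> y" "{u, v} = {x, y}"
    using mixed_graph.edges_wf[OF assms] by blast
  then show "u \<in> mverts G" "v \<in> mverts G" "u \<noteq> v"
    by (auto simp: doubleton_eq_iff)
qed

lemma wf_digraph_of:
  assumes "mixed_graph G"
  shows "wf_digraph (with_proj (digraph_of G))"
  using mixed_graph_edge_verts[OF assms] mixed_graph.arcs_wf[OF assms]
  by unfold_locales (auto simp: digraph_of_def)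

lemma ex1_edge:
  assumes "mixed_graph G" "mixed_regular 1 1 G" "u \<in> mverts G"
  shows "\<exists>!v. {u, v} \<in> medges G"
proof -
  have "card {e \<in> medges G. u \<in> e} = 1"
    using assms by (simp add: mixed_regular_def undirected_degree_def)
  then obtain e where e: "{e \<in> medges G. u \<in> e} = {e}"
    by (auto simp: card_1_singleton_iff)
  then have "e \<in> medges G" "u \<in> e" by auto
  then obtain v where v: "e = {u, v}" "u \<noteq> v"
    using mixed_graph.edges_wf[OF assms(1)] by (metis insertE insert_commute singletonD)
  have "w = v" if "{u, w} \<in> medges G" for w
  proof -
    have "{u, w} \<in> {e \<in> medges G. u \<in> e}" using that by simp
    then have "{u, w} = {u, v}" unfolding e v by (rule singletonD)
    with v show ?thesis by (auto simp: doubleton_eq_iff)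
  qed
  with \<open>e \<in> medges G\<close> v show ?thesis by blast
qed

lemma ex1_arc_out:
  assumes "mixed_regular 1 1 G" "u \<in> mverts G"
  shows "\<exists>!v. (u, v) \<in> marcs G"
proof -
  have "card {a \<in> marcs G. fst a = u} = 1"
    using assms by (simp add: mixed_regular_def arc_out_degree_def)
  then obtain a where a: "{a \<in> marcs G. fst a = u} = {a}"
    by (auto simp: card_1_singleton_iff)
  show ?thesis
  proof (rule ex1I[of _ "snd a"])
    show "(u, snd a) \<in> marcs G" using a by force
    show "v = snd a" if "(u, v) \<in> marcs G" for v using that a by force
  qed
qed

lemma arc_in_unique:
  assumes "mixed_regular 1 1 G" "w \<in> mverts G" "(u, w) \<in> marcs G" "(v, w) \<in> marcs G"
  shows "u = v"
proof -
  have "card {a \<in> marcs G. snd a = w} = 1"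
    using assms by (simp add: mixed_regular_def arc_in_degree_def)
  then obtain a where "{a \<in> marcs G. snd a = w} = {a}"
    by (auto simp: card_1_singleton_iff)
  with assms show ?thesis by (metis (mono_tags, lifting) mem_Collect_eq prod.inject singletonD snd_conv)
qed

text \<open>
  All arcs weigh \<open>1\<close>, so the cost of a walk is its length; the infimum that defines the distance
  runs over natural numbers, and a bound \<open>n\<close> on it is met by a walk of length at most \<open>n\<close>.
\<close>

lemma short_walk_if_diameter_le:
  assumes wf: "mixed_graph G" and diam: "mixed_diameter G \<le> ereal (real n)"
    and uv: "u \<in> mverts G" "v \<in> mverts G"
  shows "\<exists>p. pre_digraph.awalk (with_proj (digraph_of G)) u p v \<and> length p \<le> n"
proof -
  interpret D: wf_digraph "with_proj (digraph_of G)" by (rule wf_digraph_of[OF wf])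
  have cost: "D.awalk_cost (\<lambda>_. 1) p = real (length p)" for p
    by (induction p) simp_all
  have "mixed_dist G u v \<le> mixed_diameter G"
    unfolding mixed_diameter_def using uv by (force intro: SUP_upper2[of "(u, v)"])
  also have "\<dots> < ereal (real (Suc n))"
    using diam by (rule order_le_less_trans) simp
  finally have "(INF p\<in>{p. D.awalk u p v}. ereal (real (length p))) < ereal (real (Suc n))"
    unfolding mixed_dist_def D.\<mu>_def cost .
  then obtain p where "D.awalk u p v" "ereal (real (length p)) < ereal (real (Suc n))"
    unfolding INF_less_iff by blast
  then show ?thesis by auto
qed

section \<open>Words in the edge involution and the arc permutation\<close>

locale one_one_regular =
  fixes G :: "'a pre_mixed_graph" and f g :: "'a \<Rightarrow> 'a"
  assumes edge_iff: "{u, v} \<in> medges G \<longleftrightarrow> u \<in> mverts G \<and> v = f u"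
    and arc_iff: "(u, v) \<in> marcs G \<longleftrightarrow> u \<in> mverts G \<and> v = g u"
    and f_closed: "u \<in> mverts G \<Longrightarrow> f u \<in> mverts G"
    and g_closed: "u \<in> mverts G \<Longrightarrow> g u \<in> mverts G"
    and f_no_fix: "u \<in> mverts G \<Longrightarrow> f u \<noteq> u"
    and g_no_fix: "u \<in> mverts G \<Longrightarrow> g u \<noteq> u"
    and f_f: "u \<in> mverts G \<Longrightarrow> f (f u) = u"
    and g_inj: "inj_on g (mverts G)"

lemma one_one_regular_if_regular:
  assumes wf: "mixed_graph G" and reg: "mixed_regular 1 1 G"
  obtains f g where "one_one_regular G f g"
proof
  define f where "f u = (THE v. {u, v} \<in> medges G)" for u
  define g where "g u = (THE v. (u, v) \<in> marcs G)" for u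
  have f: "{u, f u} \<in> medges G" if "u \<in> mverts G" for u
    unfolding f_def by (rule theI') (rule ex1_edge[OF wf reg that])
  have f_uniq: "v = f u" if "{u, v} \<in> medges G" for u v
    using f[of u] ex1_edge[OF wf reg, of u] mixed_graph_edge_verts[OF wf that] that by blast
  have g: "(u, g u) \<in> marcs G" if "u \<in> mverts G" for u
    unfolding g_def by (rule theI') (rule ex1_arc_out[OF reg that])
  have g_uniq: "v = g u" if "(u, v) \<in> marcs G" for u v
    using g[of u] ex1_arc_out[OF reg, of u] mixed_graph.arcs_wf[OF wf that] that by blast
  show "one_one_regular G f g"
  proof
    fix u v
    show "{u, v} \<in> medges G \<longleftrightarrow> u \<in> mverts G \<and> v = f u"
      using f f_uniq mixed_graph_edge_verts[OF wf] by blast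
    show "(u, v) \<in> marcs G \<longleftrightarrow> u \<in> mverts G \<and> v = g u"
      using g g_uniq mixed_graph.arcs_wf[OF wf] by blast
    show "inj_on g (mverts G)"
      using g mixed_graph.arcs_wf[OF wf] arc_in_unique[OF reg] by (metis inj_onI)
    assume u: "u \<in> mverts G"
    show "f u \<in> mverts G" "f u \<noteq> u" using mixed_graph_edge_verts[OF wf f[OF u]] by auto
    show "g u \<in> mverts G" "g u \<noteq> u" using mixed_graph.arcs_wf[OF wf g[OF u]] by auto
    show "f (f u) = u" using f_uniq[of "f u" u] f[OF u] by (simp add: insert_commute)
  qed
qed

context one_one_regular
begin

abbreviation "V \<equiv> mverts G"

lemmas perm_simps = f_closed g_closed f_no_fix g_no_fix f_f

lemma f_eq_iff: "u \<in> V \<Longrightarrow> v \<in> V \<Longrightarrow> f u = f v \<longleftrightarrow> u = v"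
  by (metis f_f)

lemma f_flip: "f u = v \<Longrightarrow> u \<in> V \<Longrightarrow> f v = u"
  using f_f by blast

lemma g_eq_iff: "u \<in> V \<Longrightarrow> v \<in> V \<Longrightarrow> g u = g v \<longleftrightarrow> u = v"
  using g_inj by (auto dest: inj_onD)

text \<open>
  The core words come in pairs swapped by \<open>f\<close>. The three further words in \<open>words\<close>, called leaves
  below, are those of length three whose last step is an arc: they are the ones whose image under
  \<open>f\<close> is not a word of length at most three.
\<close>

definition core_words :: "'a \<Rightarrow> 'a list" where
  "core_words u = [u, f u, g u, f (g u), g (f u), f (g (f u)), g (g u), f (g (g u))]"

definition words :: "'a \<Rightarrow> 'a list" where
  "words u = core_words u @ [g (g (f u)), g (f (g u)), g (g (g u))]"

lemma words_in_V: "u \<in> V \<Longrightarrow> set (words u) \<subseteq> V"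
  by (simp add: words_def core_words_def perm_simps)

lemma core_words_closed: "u \<in> V \<Longrightarrow> v \<in> set (core_words u) \<Longrightarrow> f v \<in> set (core_words u)"
  by (auto simp: core_words_def perm_simps)

text \<open>
  Each step of a walk applies \<open>f\<close> or \<open>g\<close>, and two consecutive edge steps cancel, so the end of a walk of
  length at most three is the value of one of the eleven words.
\<close>

lemma V_subset_words_if_diameter_le_3:
  assumes wf: "mixed_graph G" and diam: "mixed_diameter G \<le> 3" and u: "u \<in> V"
  shows "V \<subseteq> set (words u)"
proof
  fix v assume v: "v \<in> V"
  interpret D: wf_digraph "with_proj (digraph_of G)" by (rule wf_digraph_of[OF wf])
  obtain p where p: "D.awalk u p v" "length p \<le> 3"
    using short_walk_if_diameter_le[OF wf, of 3 u v] diam u v by auto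
  have step: "x \<in> V \<and> (D.awalk (f x) q v \<or> D.awalk (g x) q v)"
    if "D.awalk x (a # q) v" for x a q
  proof -
    have "a \<in> parcs (digraph_of G)" "x = fst a" "D.awalk (snd a) q v"
      using that by (simp_all add: D.awalk_Cons_iff)
    moreover from this have "fst a \<in> V \<and> (snd a = f (fst a) \<or> snd a = g (fst a))"
      by (cases a) (auto simp: digraph_of_def edge_iff arc_iff)
    ultimately show ?thesis by auto
  qed
  consider "p = []" | a where "p = [a]" | a b where "p = [a, b]" | a b c where "p = [a, b, c]"
    using p(2) by (auto simp: le_Suc_eq numeral_3_eq_3 length_Suc_conv)
  then show "v \<in> set (words u)"
    using p(1)
    by cases (auto simp: D.awalk_Nil_iff words_def core_words_def f_f dest!: step)
qed

end

section \<open>One coincidence per vertex\<close>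

locale defect_one = one_one_regular +
  assumes card_V: "card (mverts G) = 10"
    and V_subset_words: "u \<in> mverts G \<Longrightarrow> mverts G \<subseteq> set (words u)"
begin

lemma length_ge_if_covers: "V \<subseteq> set zs \<Longrightarrow> 10 \<le> length zs"
  by (metis card_V card_mono card_length finite_set order_trans)

text \<open>
  The next five relations each bring a second coincidence with them: under the assumption the words
  take at most nine values, the ones listed in the proof, which cannot cover ten vertices.
\<close>

lemma f_neq_g:
  assumes u: "u \<in> V"
  shows "f u \<noteq> g u"
proof
  assume "f u = g u"
  then have "set (words u) \<subseteq> set [u, g u, f (g u), g (g u), f (g (g u)), g (g (g u)), g (f (g u))]"
    using u by (auto simp: words_def core_words_def perm_simps)
  from length_ge_if_covers[OF order_trans[OF V_subset_words[OF u] this]] show False by simp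
qed

lemma g_g_neq:
  assumes u: "u \<in> V"
  shows "g (g u) \<noteq> u"
proof
  assume "g (g u) = u"
  then have "set (words u) \<subseteq> set [u, f u, g u, f (g u), g (f u), f (g (f u)), g (g (f u)), g (f (g u))]"
    using u by (auto simp: words_def core_words_def perm_simps)
  from length_ge_if_covers[OF order_trans[OF V_subset_words[OF u] this]] show False by simp
qed

lemma g_g_neq_f:
  assumes u: "u \<in> V"
  shows "g (g u) \<noteq> f u"
proof
  assume "g (g u) = f u"
  then have "set (words u) \<subseteq> set [u, f u, g u, f (g u), g (f u), f (g (f u)), g (g (f u)), g (f (g u))]"
    using u by (auto simp: words_def core_words_def perm_simps)
  from length_ge_if_covers[OF order_trans[OF V_subset_words[OF u] this]] show False by simp
qed

lemma f_g_neq_g_f: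
  assumes u: "u \<in> V"
  shows "f (g u) \<noteq> g (f u)"
proof
  assume *: "f (g u) = g (f u)"
  then have "f (g (f u)) = g u" using f_flip[OF *] u by (simp add: perm_simps)
  with * have "set (words u) \<subseteq> set [u, f u, g u, f (g u), g (g u), f (g (g u)), g (g (f u)), g (g (g u))]"
    using u by (auto simp: words_def core_words_def perm_simps)
  from length_ge_if_covers[OF order_trans[OF V_subset_words[OF u] this]] show False by simp
qed

lemma f_g_f_neq_g_g:
  assumes u: "u \<in> V"
  shows "f (g (f u)) \<noteq> g (g u)"
proof
  assume *: "f (g (f u)) = g (g u)"
  then have "f (g (g u)) = g (f u)" using u by (metis f_f f_closed g_closed)
  with * have "set (words u) \<subseteq>
      set [u, f u, g u, f (g u), g (f u), g (g u), g (g (f u)), g (f (g u)), g (g (g u))]"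
    using u by (auto simp: words_def core_words_def perm_simps)
  from length_ge_if_covers[OF order_trans[OF V_subset_words[OF u] this]] show False by simp
qed

text \<open>
  Eight core words and two leaves can cover ten vertices only without repetition. As \<open>f\<close> permutes
  the core, it maps the set of the two leaves to itself, and having no fixed point it swaps them.
\<close>

lemma leaves_adjacent:
  assumes u: "u \<in> V" and x: "x \<in> V" and cov: "V \<subseteq> set (core_words u @ [x, y])"
  shows "f x = y"
proof -
  have "x \<notin> set (core_words u)"
  proof
    assume "x \<in> set (core_words u)"
    with cov have "V \<subseteq> set (core_words u @ [y])" by auto
    from length_ge_if_covers[OF this] show False by (simp add: core_words_def)
  qed
  then have "f x \<notin> set (core_words u)"
    using core_words_closed[OF u] x by (metis f_f)
  moreover have "f x \<in> set (core_words u @ [x, y])" using cov x f_closed by blast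
  ultimately show ?thesis using f_no_fix[OF x] by auto
qed

lemma leaves_adjacent_if_ggg_redundant:
  assumes u: "u \<in> V" and "g (g (g u)) \<in> set (core_words u)"
  shows "f (g (f (g u))) = g (g (f u))"
proof (rule leaves_adjacent[OF u])
  show "V \<subseteq> set (core_words u @ [g (f (g u)), g (g (f u))])"
    using V_subset_words[OF u] assms(2) by (auto simp: words_def)
qed (use u in \<open>simp add: perm_simps\<close>)

lemma leaves_adjacent_if_gfg_redundant:
  assumes u: "u \<in> V" and "g (f (g u)) \<in> set (core_words u)"
  shows "f (g (g (f u))) = g (g (g u))"
proof (rule leaves_adjacent[OF u])
  show "V \<subseteq> set (core_words u @ [g (g (f u)), g (g (g u))])"
    using V_subset_words[OF u] assms(2) by (auto simp: words_def)
qed (use u in \<open>simp add: perm_simps\<close>)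

text \<open>
  Otherwise the leaves \<open>g (f (g u))\<close> and \<open>g (g (g u))\<close> would be adjacent, and \<open>f_g_f_neq_g_g\<close> forbids this
  at the vertex \<open>g u\<close>.
\<close>

lemma g_g_f_not_redundant:
  assumes u: "u \<in> V"
  shows "g (g (f u)) \<notin> set (core_words u)"
proof
  assume "g (g (f u)) \<in> set (core_words u)"
  then have "V \<subseteq> set (core_words u @ [g (f (g u)), g (g (g u))])"
    using V_subset_words[OF u] by (auto simp: words_def)
  then have "f (g (f (g u))) = g (g (g u))"
    by (intro leaves_adjacent[OF u]) (use u in \<open>simp_all add: perm_simps\<close>)
  with f_g_f_neq_g_g[of "g u"] u show False by (simp add: perm_simps)
qed

text \<open>
  A directed triangle is a single coincidence at each of its vertices, so counting words is not
  enough. But the leaf \<open>g (g (g x))\<close> is then redundant at each vertex \<open>x\<close> of the triangle, and the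
  other two leaves are adjacent. In terms of the arcs \<open>f u \<rightarrow> a\<close>, \<open>f v \<rightarrow> b\<close>, \<open>f w \<rightarrow> c\<close> out of the
  neighbours of the triangle, this says \<open>g a = f b\<close>, \<open>g b = f c\<close> and \<open>g c = f a\<close>, which leaves no place
  for \<open>c\<close> among the ten words at \<open>u\<close>.
\<close>

lemma g_g_g_neq:
  assumes u: "u \<in> V"
  shows "g (g (g u)) \<noteq> u"
proof
  assume tri: "g (g (g u)) = u"
  define v w where "v = g u" and "w = g v"
  note vw = v_def[symmetric] w_def[symmetric]
  have V: "v \<in> V" "w \<in> V" and gw: "g w = u"
    using u tri by (simp_all add: v_def w_def perm_simps)
  define a b c where "a = g (f u)" and "b = g (f v)" and "c = g (f w)"
  note abc = a_def[symmetric] b_def[symmetric] c_def[symmetric]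
  have abcV: "a \<in> V" "b \<in> V" "c \<in> V"
    using u V by (simp_all add: a_def b_def c_def perm_simps)
  have ga: "g a = f b" and gb: "g b = f c" and gc: "g c = f a"
    using leaves_adjacent_if_ggg_redundant[of u] leaves_adjacent_if_ggg_redundant[of v]
      leaves_adjacent_if_ggg_redundant[of w] u V abcV
    by (simp_all add: core_words_def vw gw abc)
  have "V \<subseteq> {u, f u, v, f v, a, f a, w, f w, f b, b}"
    using V_subset_words[OF u] by (auto simp: words_def core_words_def vw gw abc ga)
  then have "c \<in> {u, f u, v, f v, a, f a, w, f w, f b, b}" using abcV by blast
  moreover have "c \<noteq> f b" using gb abcV f_f g_no_fix by metis
  moreover have "c \<noteq> f a" using gc abcV g_no_fix by metis
  moreover have "c \<noteq> u" using g_eq_iff[of "f w" w] gw V f_no_fix[of w] by (simp add: c_def f_closed)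
  moreover have "c \<noteq> a" using gw g_no_fix[of w] u V by (auto simp: c_def a_def g_eq_iff f_eq_iff f_closed)
  moreover have "c \<noteq> b"
    using g_no_fix[of v] V by (simp add: c_def b_def w_def g_eq_iff f_eq_iff f_closed)
  moreover have "c \<noteq> f u" using f_g_neq_g_f[of w] V gw by (auto simp: c_def)
  moreover have "c \<noteq> v" using f_neq_g[of w] V u gw by (auto simp: c_def v_def g_eq_iff f_closed)
  moreover have "c \<noteq> f v" using f_g_f_neq_g_g[of w] V gw by (auto simp: c_def v_def f_f g_closed)
  moreover have "c \<noteq> w" using g_g_neq_f[of w] V gw g_eq_iff[of "f w" v]
    unfolding c_def by (metis v_def w_def f_closed)
  moreover have "c \<noteq> f w" using g_no_fix[of "f w"] V by (simp add: c_def f_closed)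
  ultimately show False by blast
qed

text \<open>
  The excluded relations, together with what they give at the vertices \<open>f u\<close> and \<open>f (g u)\<close> or after
  applying \<open>f\<close> to both sides.
\<close>

lemma word_neqs:
  assumes u: "u \<in> V"
  shows "f u \<noteq> u" "g u \<noteq> u" "f u \<noteq> g u" "f (g u) \<noteq> u" "g (f u) \<noteq> u" "g (g u) \<noteq> u"
    "g (g u) \<noteq> f u" "f (g (g u)) \<noteq> u" "g (f (g u)) \<noteq> u" "g (g (g u)) \<noteq> u"
    "f (g u) \<noteq> g (f u)" "f (g (f u)) \<noteq> u" "f (g (f u)) \<noteq> g u"
    "f (g (f u)) \<noteq> g (g u)" "f (g (g u)) \<noteq> g (f u)"
proof -
  show "f u \<noteq> u" "g u \<noteq> u" "f u \<noteq> g u" "g (g u) \<noteq> u" "g (g u) \<noteq> f u" "g (g (g u)) \<noteq> u"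
    "f (g u) \<noteq> g (f u)" "f (g (f u)) \<noteq> g (g u)"
    by (fact f_no_fix[OF u] g_no_fix[OF u] f_neq_g[OF u] g_g_neq[OF u] g_g_neq_f[OF u]
      g_g_g_neq[OF u] f_g_neq_g_f[OF u] f_g_f_neq_g_g[OF u])+
  show "f (g u) \<noteq> u" using f_neq_g[OF u] f_f[OF g_closed[OF u]] by metis
  show "g (f u) \<noteq> u" using f_neq_g[of "f u"] u by (simp add: f_closed f_f)
  show "f (g (g u)) \<noteq> u" using g_g_neq_f[OF u] u by (metis f_f g_closed)
  show "g (f (g u)) \<noteq> u" using g_g_neq_f[of "f (g u)"] u by (auto simp: perm_simps)
  show "f (g (f u)) \<noteq> u" using g_no_fix[of "f u"] u by (metis f_f f_closed g_closed)
  show "f (g (f u)) \<noteq> g u" using f_g_neq_g_f[OF u] u by (metis f_f f_closed g_closed)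
  show "f (g (g u)) \<noteq> g (f u)" using f_g_f_neq_g_g[OF u] u by (metis f_f g_closed)
qed

text \<open>
  Eleven words with ten values coincide somewhere, and every other pair of words is separated by
  injectivity, an excluded relation or \<open>g_g_f_not_redundant\<close>.
\<close>

lemma coincidence:
  assumes u: "u \<in> V"
  shows "g (f (g u)) = f u \<or> g (g (g u)) = f u
    \<or> g (f (g u)) = f (g (f u)) \<or> g (g (g u)) = f (g (f u))"
proof (rule ccontr)
  assume neg: "\<not> ?thesis"
  have "distinct (core_words u)"
    using u by (simp add: core_words_def word_neqs word_neqs[symmetric] f_eq_iff g_eq_iff
        f_closed g_closed)
  then have "distinct (words u)"
    using neg g_g_f_not_redundant[OF u] u
    by (auto simp: words_def core_words_def word_neqs word_neqs[symmetric] f_eq_iff g_eq_iff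
        f_closed g_closed)
  then have "card (set (words u)) = length (words u)" by (rule distinct_card)
  moreover have "card (set (words u)) \<le> 10"
    using words_in_V[OF u] card_V by (metis card_mono card.infinite zero_neq_numeral)
  ultimately show False by (simp add: words_def core_words_def)
qed

text \<open>
  Since \<open>g (g (g u))\<close> is redundant, the leaves \<open>g (f (g u))\<close> and \<open>g (g (f u))\<close> are adjacent. With this, each
  of the other three types of coincidence at \<open>g u\<close> turns into an excluded relation at \<open>u\<close>.
\<close>

lemma gfg_eq_f_at_g_if_ggg_eq_f:
  assumes u: "u \<in> V" and eq: "g (g (g u)) = f u"
  shows "g (f (g (g u))) = f (g u)"
proof -
  have leaf: "f (g (f (g u))) = g (g (f u))"
    using leaves_adjacent_if_ggg_redundant[OF u] u eq
    by (simp add: core_words_def)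
  have "g (g (g (g u))) \<noteq> f (g u)"
    using eq u word_neqs[of u] by simp
  moreover have "g (f (g (g u))) \<noteq> f (g (f (g u)))"
    using leaf u by (simp add: word_neqs g_eq_iff f_closed g_closed)
  moreover have "g (g (g (g u))) \<noteq> f (g (f (g u)))"
    using leaf eq u by (simp add: word_neqs word_neqs[symmetric] g_eq_iff f_closed g_closed)
  ultimately show ?thesis using coincidence[OF g_closed[OF u]] by blast
qed

text \<open>
  If \<open>u\<close> has one of the other two types, then \<open>g u\<close> has neither of them, unless \<open>g (g (g u)) = f u\<close>.
\<close>

lemma ex_ggg_or_gfg_eq_f:
  assumes u: "u \<in> V"
  shows "\<exists>v\<in>V. g (f (g v)) = f v \<or> g (g (g v)) = f v"
proof -
  consider "g (f (g u)) = f u \<or> g (g (g u)) = f u"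
    | (gfg) "g (f (g u)) = f (g (f u))" | (ggg) "g (g (g u)) = f (g (f u))"
    using coincidence[OF u] by blast
  then show ?thesis
  proof cases
    case 1
    with u show ?thesis by blast
  next
    case gfg
    then have gu: "f (g (f (g u))) = g (f u)" using u by (simp add: f_f f_closed g_closed)
    have "g (f (g (g u))) \<noteq> f (g (f (g u)))"
      using gu u by (simp add: word_neqs f_eq_iff g_eq_iff f_closed g_closed)
    then have "g (f (g (g u))) = f (g u) \<or> g (g (g (g u))) = f (g u) \<or> g (g (g u)) = f u"
      using coincidence[of "g u"] gu u by (auto simp: g_eq_iff f_closed g_closed)
    then show ?thesis using u g_closed by blast
  next
    case ggg
    then have leaf: "f (g (f (g u))) = g (g (f u))"
      using leaves_adjacent_if_ggg_redundant[OF u] u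
      by (simp add: core_words_def)
    have "g (f (g (g u))) \<noteq> f (g (f (g u)))"
      using leaf u by (simp add: word_neqs g_eq_iff f_closed g_closed)
    moreover have "g (g (g (g u))) \<noteq> f (g (f (g u)))"
      using leaf ggg u by (simp add: word_neqs g_eq_iff f_closed g_closed)
    ultimately show ?thesis
      using coincidence[OF g_closed[OF u]] u g_closed by blast
  qed
qed

lemma ex_gfg_eq_f: "\<exists>u\<in>V. g (f (g u)) = f u"
proof -
  obtain u where "u \<in> V" using card_V by fastforce
  then show ?thesis
    using ex_ggg_or_gfg_eq_f gfg_eq_f_at_g_if_ggg_eq_f g_closed by metis
qed

end

section \<open>Completing the arcs\<close>

lemma atLeastAtMost_0_9: "{0..9} = {0, 1, 2, 3, 4, 5, 6, 7, 8, 9 :: nat}"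
  by auto

context one_one_regular
begin

text \<open>
  No vertex of \<open>G\<close> has room for a second edge or outgoing arc, so the edge and arc that \<open>H\<close> provides at
  every vertex already account for all of \<open>G\<close>, and the inverse of \<open>h\<close> preserves edges and arcs too.
\<close>

lemma mixed_iso_if_bij_hom:
  assumes bij: "bij_betw h (mverts H) V"
    and edge: "\<And>i j. {i, j} \<in> medges H \<Longrightarrow> {h i, h j} \<in> medges G"
    and arc: "\<And>i j. (i, j) \<in> marcs H \<Longrightarrow> (h i, h j) \<in> marcs G"
    and ex_edge: "\<And>i. i \<in> mverts H \<Longrightarrow> \<exists>j\<in>mverts H. {i, j} \<in> medges H"
    and ex_arc: "\<And>i. i \<in> mverts H \<Longrightarrow> \<exists>j\<in>mverts H. (i, j) \<in> marcs H"
  shows "mixed_iso G H"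
proof -
  define k where "k = the_inv_into (mverts H) h"
  have k: "bij_betw k V (mverts H)"
    unfolding k_def by (rule bij_betw_the_inv_into[OF bij])
  have hk: "h (k u) = u" if "u \<in> V" for u
    using f_the_inv_into_f_bij_betw[OF bij] that by (simp add: k_def)
  have kV: "k u \<in> mverts H" if "u \<in> V" for u
    using k that by (auto simp: bij_betw_def)
  have inj: "i = j" if "h i = h j" "i \<in> mverts H" "j \<in> mverts H" for i j
    using bij that by (auto simp: bij_betw_def dest: inj_onD)
  have "{k u, k v} \<in> medges H" if uv: "u \<in> V" "v \<in> V" "{u, v} \<in> medges G" for u v
  proof -
    obtain j where j: "j \<in> mverts H" "{k u, j} \<in> medges H" using ex_edge kV uv by blast
    then have "h j = f u" using edge[OF j(2)] uv by (simp add: hk edge_iff)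
    then have "h j = h (k v)" using uv by (simp add: hk edge_iff)
    then show ?thesis using inj[of j "k v"] j kV uv by simp
  qed
  moreover have "(k u, k v) \<in> marcs H" if uv: "u \<in> V" "v \<in> V" "(u, v) \<in> marcs G" for u v
  proof -
    obtain j where j: "j \<in> mverts H" "(k u, j) \<in> marcs H" using ex_arc kV uv by blast
    then have "h j = g u" using arc[OF j(2)] uv by (simp add: hk arc_iff)
    then have "h j = h (k v)" using uv by (simp add: hk arc_iff)
    then show ?thesis using inj[of j "k v"] j kV uv by simp
  qed
  ultimately show ?thesis
    unfolding mixed_iso_def using k edge arc hk by (intro exI[of _ k]) metis
qed

text \<open>A numbering of the vertices under which the edges are the common edges of the three graphs.\<close>

definition edge_labelling :: "'a list \<Rightarrow> bool" where
  "edge_labelling xs \<longleftrightarrow> length xs = 10 \<and> distinct xs \<and> set xs = V \<and>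
     f (xs ! 0) = xs ! 1 \<and> f (xs ! 2) = xs ! 4 \<and> f (xs ! 3) = xs ! 6 \<and>
     f (xs ! 5) = xs ! 9 \<and> f (xs ! 7) = xs ! 8"

lemma mixed_iso_if_edge_labelling:
  assumes xs: "edge_labelling xs"
    and H: "mverts H = {0..9}" "medges H = common_edges"
    and arcs: "marcs H \<subseteq> {0..9} \<times> {0..9}" "{0..9} \<subseteq> fst ` marcs H"
    and succ: "\<forall>(i, j) \<in> marcs H. g (xs ! i) = xs ! j"
  shows "mixed_iso G H"
proof (rule mixed_iso_if_bij_hom[where h = "\<lambda>i. xs ! i"])
  have xs_V: "xs ! i \<in> V" if "i \<le> 9" for i
    using xs that nth_mem[of i xs] by (simp add: edge_labelling_def)
  show "bij_betw ((!) xs) (mverts H) V"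
    using xs by (intro bij_betw_nth) (auto simp: edge_labelling_def H)
  show "{xs ! i, xs ! j} \<in> medges G" if "{i, j} \<in> medges H" for i j
  proof -
    have edge: "{xs ! m, xs ! n} \<in> medges G" if "f (xs ! m) = xs ! n" "m \<le> 9" for m n
      using that xs_V by (simp add: edge_iff)
    have "(`) ((!) xs) ` common_edges \<subseteq> medges G"
      using xs edge by (simp add: edge_labelling_def common_edges_def)
    moreover have "(!) xs ` {i, j} \<in> (`) ((!) xs) ` common_edges"
      using that unfolding H by (rule imageI)
    ultimately show ?thesis by (auto simp only: image_insert image_empty)
  qed
  show "(xs ! i, xs ! j) \<in> marcs G" if "(i, j) \<in> marcs H" for i j
    using that succ arcs xs_V by (auto simp: arc_iff)
  show "\<exists>j\<in>mverts H. {i, j} \<in> medges H" if "i \<in> mverts H" for i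
    using that unfolding H atLeastAtMost_0_9 common_edges_def by (auto simp: doubleton_eq_iff)
  show "\<exists>j\<in>mverts H. (i, j) \<in> marcs H" if "i \<in> mverts H" for i
    using that arcs unfolding H by force
qed

end

context defect_one
begin

text \<open>
  The vertices \<open>a0\<close>, \<open>a2\<close>, \<open>a4\<close>, \<open>a1\<close> form a square in which the arcs \<open>a0 \<rightarrow> a2\<close> and \<open>a4 \<rightarrow> a1\<close>
  alternate with edges. The four missing arcs lead from \<open>a6\<close>, \<open>a7\<close>, \<open>a8\<close>, \<open>a9\<close> to \<open>a0\<close>, \<open>a4\<close>, \<open>a6\<close>, \<open>a9\<close>.
  Loops, directed digons, and two consecutive arcs between the ends of an edge are excluded, and
  this leaves six of the 24 possibilities. Some of the six are isomorphic to each other, since the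
  half turn of the square, which swaps \<open>a0\<close> with \<open>a4\<close> and \<open>a1\<close> with \<open>a2\<close>, and other vertices with such
  a square give further labellings.
\<close>

lemma mixed_iso_if_square:
  assumes lab: "edge_labelling [a0, a1, a2, a3, a4, a5, a6, a7, a8, a9]"
    and g: "g a0 = a2" "g a1 = a3" "g a2 = a5" "g a3 = a7" "g a4 = a1" "g a5 = a8"
  shows "mixed_iso G G\<^sub>a \<or> mixed_iso G G\<^sub>b \<or> mixed_iso G G\<^sub>c"
proof -
  have V: "V = {a0, a1, a2, a3, a4, a5, a6, a7, a8, a9}"
    and dist: "distinct [a0, a1, a2, a3, a4, a5, a6, a7, a8, a9]"
    and f: "f a0 = a1" "f a2 = a4" "f a3 = a6" "f a5 = a9" "f a7 = a8"
    using lab by (simp_all add: edge_labelling_def)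
  have f': "f a1 = a0" "f a4 = a2" "f a6 = a3" "f a9 = a5" "f a8 = a7"
    using f f_flip V by blast+
  have free: "g x \<in> {a0, a4, a6, a9}" if "x \<in> {a6, a7, a8, a9}" for x
  proof -
    have "g x \<notin> g ` {a0, a1, a2, a3, a4, a5}"
      using that dist V by (subst inj_on_image_mem_iff[OF g_inj]) auto
    moreover have "g x \<in> V" using that V by (intro g_closed) auto
    ultimately show ?thesis unfolding V using g by auto
  qed
  have inj: "g a6 \<noteq> g a7" "g a6 \<noteq> g a8" "g a6 \<noteq> g a9" "g a7 \<noteq> g a8" "g a7 \<noteq> g a9" "g a8 \<noteq> g a9"
    using dist V by (simp_all add: g_eq_iff)
  have no_loop: "g a6 \<noteq> a6" "g a9 \<noteq> a9" using V by (simp_all add: g_no_fix)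
  \<comment> \<open>Through \<open>a7\<close>, two arcs would lead from \<open>a3\<close> to its neighbour \<open>a6\<close>; likewise from \<open>a5\<close> to \<open>a9\<close>.\<close>
  have "g a7 \<noteq> a6" using g_g_neq_f[of a3] V f g by simp
  have "g a8 \<noteq> a9" using g_g_neq_f[of a5] V f g by simp
  have no_digon: "\<not> (g a6 = a9 \<and> g a9 = a6)" using g_g_neq[of a6] V by auto
  consider "g a6 = a0" "g a7 = a9" "g a8 = a6" "g a9 = a4"
    | "g a6 = a0" "g a7 = a9" "g a8 = a4" "g a9 = a6"
    | "g a6 = a4" "g a7 = a9" "g a8 = a6" "g a9 = a0"
    | "g a6 = a4" "g a7 = a9" "g a8 = a0" "g a9 = a6"
    | "g a6 = a9" "g a7 = a4" "g a8 = a6" "g a9 = a0"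
    | "g a6 = a9" "g a7 = a0" "g a8 = a6" "g a9 = a4"
    using free[of a6] free[of a7] free[of a8] free[of a9] inj no_loop \<open>g a7 \<noteq> a6\<close> \<open>g a8 \<noteq> a9\<close> no_digon
    by simp metis
  then show ?thesis
  proof cases
    case 1
    have "mixed_iso G G\<^sub>a"
      by (rule mixed_iso_if_edge_labelling[OF lab])
        (auto simp: G\<^sub>a_def atLeastAtMost_0_9 g 1)
    then show ?thesis by blast
  next
    case 2
    \<comment> \<open>the half turn of the square\<close>
    have "edge_labelling [a4, a2, a1, a5, a0, a3, a9, a8, a7, a6]"
      using dist V f f' by (auto simp: edge_labelling_def)
    then have "mixed_iso G G\<^sub>b"
      by (rule mixed_iso_if_edge_labelling)
        (auto simp: G\<^sub>b_def atLeastAtMost_0_9 g 2)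
    then show ?thesis by blast
  next
    case 3
    \<comment> \<open>the labelling that starts from the square \<open>a3 \<rightarrow> a7\<close>, \<open>a8 \<rightarrow> a6\<close>\<close>
    have "edge_labelling [a3, a6, a7, a4, a8, a9, a2, a1, a0, a5]"
      using dist V f f' by (auto simp: edge_labelling_def)
    then have "mixed_iso G G\<^sub>b"
      by (rule mixed_iso_if_edge_labelling)
        (auto simp: G\<^sub>b_def atLeastAtMost_0_9 g 3)
    then show ?thesis by blast
  next
    case 4
    have "edge_labelling [a4, a2, a1, a5, a0, a3, a9, a8, a7, a6]"
      using dist V f f' by (auto simp: edge_labelling_def)
    then have "mixed_iso G G\<^sub>c"
      by (rule mixed_iso_if_edge_labelling)
        (auto simp: G\<^sub>c_def atLeastAtMost_0_9 g 4)
    then show ?thesis by blast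
  next
    case 5
    have "mixed_iso G G\<^sub>c"
      by (rule mixed_iso_if_edge_labelling[OF lab])
        (auto simp: G\<^sub>c_def atLeastAtMost_0_9 g 5)
    then show ?thesis by blast
  next
    case 6
    have "mixed_iso G G\<^sub>b"
      by (rule mixed_iso_if_edge_labelling[OF lab])
        (auto simp: G\<^sub>b_def atLeastAtMost_0_9 g 6)
    then show ?thesis by blast
  qed
qed

lemma mixed_iso_a_or_b_or_c: "mixed_iso G G\<^sub>a \<or> mixed_iso G G\<^sub>b \<or> mixed_iso G G\<^sub>c"
proof -
  obtain u where u: "u \<in> V" "g (f (g u)) = f u" using ex_gfg_eq_f by blast
  let ?xs = "[u, f u, g u, g (f u), f (g u), g (g u), f (g (f u)), g (g (f u)), g (g (g u)), f (g (g u))]"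
  have sub: "set ?xs \<subseteq> V" using u by (simp add: f_closed g_closed)
  have cov: "V \<subseteq> set ?xs" using V_subset_words[OF u(1)] u by (auto simp: words_def core_words_def)
  with sub have V: "set ?xs = V" by blast
  have "distinct ?xs" by (rule card_distinct) (simp add: V card_V del: list.set)
  moreover have "f (g (g (f u))) = g (g (g u))"
    using leaves_adjacent_if_gfg_redundant[OF u(1)] u by (simp add: core_words_def)
  ultimately have "edge_labelling ?xs" using V by (simp add: edge_labelling_def)
  then show ?thesis by (rule mixed_iso_if_square) (simp_all add: u)
qed

end

section \<open>The line digraph of the pentagon\<close>

lemma parcs_cycle_graph_5:
  "parcs (digraph_of (cycle_graph 5)) =
    {(0, 1), (1, 2), (2, 3), (3, 4), (4, 0), (1, 0), (2, 1), (3, 2), (4, 3), (0, 4)}"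
proof -
  have "{{i, Suc i mod 5} |i. i < 5} = (\<lambda>i. {i, Suc i mod 5}) ` {..<5}" by auto
  also have "{..<5} = {0, 1, 2, 3, 4 :: nat}" by auto
  also have "(\<lambda>i. {i, Suc i mod 5}) ` \<dots> = {{0, 1}, {1, 2}, {2, 3}, {3, 4}, {4, 0}}"
    by (simp add: numeral_2_eq_2)
  finally show ?thesis
    by (auto simp: digraph_of_def cycle_graph_def doubleton_eq_iff)
qed

lemma parcs_G_a:
  "parcs (digraph_of G\<^sub>a) =
    {(0, 2), (2, 5), (5, 8), (8, 6), (6, 0), (1, 3), (3, 7), (7, 9), (9, 4), (4, 1),
     (0, 1), (2, 4), (3, 6), (5, 9), (7, 8), (1, 0), (4, 2), (6, 3), (9, 5), (8, 7)}"
  by (auto simp: digraph_of_def G\<^sub>a_def common_edges_def doubleton_eq_iff)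

lemma pverts_G_a: "pverts (digraph_of G\<^sub>a) = {0..9}"
  by (simp add: digraph_of_def G\<^sub>a_def)

lemma wf_digraph_G_a: "wf_digraph (with_proj (digraph_of G\<^sub>a))"
  by unfold_locales (auto simp: parcs_G_a pverts_G_a)

lemma G_a_iso_line_digraph_cycle_5:
  "digraph_iso (with_proj (digraph_of G\<^sub>a))
    (with_proj (line_digraph (digraph_of (cycle_graph 5))))"
proof -
  define h :: "nat \<Rightarrow> nat \<times> nat" where
    "h i = [(0, 1), (1, 0), (1, 2), (0, 4), (2, 1), (2, 3), (4, 0), (4, 3), (3, 4), (3, 2)] ! i" for i
  \<comment> \<open>The vertices on the directed cycle \<open>0 2 5 8 6\<close> become the forward arcs \<open>(i, i + 1)\<close> of the pentagon
    and their neighbours the reversed arcs, so that the digons of \<open>G\<^sub>a\<close> join opposite arcs.\<close>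
  define iso where "iso = \<lparr>iso_verts = h, iso_arcs = map_prod h h, iso_head = snd, iso_tail = fst\<rparr>"
  let ?D = "with_proj (digraph_of G\<^sub>a)" and ?L = "line_digraph (digraph_of (cycle_graph 5))"
  have verts: "verts ?D = {0..9}" by (simp add: pverts_G_a)
  have inj: "inj_on h {0..9}" by (auto simp: inj_on_def h_def atLeastAtMost_0_9)
  have "arcs ?D \<subseteq> {0..9} \<times> {0..9}" by (auto simp: parcs_G_a)
  then have "inj_on (map_prod h h) (arcs ?D)"
    using map_prod_inj_on[OF inj inj] by (rule inj_on_subset[rotated])
  then have "pre_digraph.digraph_isomorphism ?D iso"
    using wf_digraph_G_a inj unfolding pre_digraph.digraph_isomorphism_def verts by (simp add: iso_def)
  moreover have "with_proj ?L = app_iso iso ?D"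
  proof -
    have "h ` {0..9} = parcs (digraph_of (cycle_graph 5))"
      unfolding atLeastAtMost_0_9 parcs_cycle_graph_5 by (auto simp: h_def)
    moreover have "map_prod h h ` parcs (digraph_of G\<^sub>a) = parcs ?L"
    proof
      show "map_prod h h ` parcs (digraph_of G\<^sub>a) \<subseteq> parcs ?L"
        by (simp add: line_digraph_def parcs_cycle_graph_5 parcs_G_a h_def)
      have "\<forall>a\<in>parcs (digraph_of (cycle_graph 5)). \<forall>b\<in>parcs (digraph_of (cycle_graph 5)).
          snd a = fst b \<longrightarrow> (a, b) \<in> map_prod h h ` parcs (digraph_of G\<^sub>a)"
        by (simp add: parcs_cycle_graph_5 parcs_G_a h_def)
      then show "parcs ?L \<subseteq> map_prod h h ` parcs (digraph_of G\<^sub>a)"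
        unfolding line_digraph_def by auto
    qed
    ultimately show ?thesis
      using verts by (simp add: app_iso_def iso_def with_proj_def line_digraph_def)
  qed
  ultimately show ?thesis unfolding digraph_iso_def by blast
qed

theorem proposition3p1:
  fixes G :: "'a pre_mixed_graph"
  assumes "mixed_graph G"
    and "mixed_regular 1 1 G"
    and "mixed_diameter G = 3"
    and "card (mverts G) = 10"
  shows "(mixed_iso G G\<^sub>a \<or> mixed_iso G G\<^sub>b \<or> mixed_iso G G\<^sub>c) \<and>
    digraph_iso (with_proj (digraph_of G\<^sub>a))
      (with_proj (line_digraph (digraph_of (cycle_graph 5))))"
proof
  obtain f g where "one_one_regular G f g"
    using one_one_regular_if_regular assms by blast
  then interpret one_one_regular G f g .
  interpret defect_one G f g
    using assms V_subset_words_if_diameter_le_3 by unfold_locales simp_all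
  show "mixed_iso G G\<^sub>a \<or> mixed_iso G G\<^sub>b \<or> mixed_iso G G\<^sub>c" by (rule mixed_iso_a_or_b_or_c)
qed (rule G_a_iso_line_digraph_cycle_5)

end
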